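(* Let $F$ be a field of characteristic not $2$, let $(V,B)$ be a finite-dimensional symplectic vector space over $F$, and let $l_1,\ldots,l_n$ ($n\ge 2$) be Lagrangian subspaces of $V$, indexed by $\mathbb Z/n\mathbb Z$. Then $$\ker q_{1,2,\ldots,n}=\operatorname{im}\partial$$ as subspaces of $K_{1,2,\ldots,n}$. In other words, $T_{1,2,\ldots,n}=K_{1,2,\ldots,n}/\ker q_{1,2,\ldots,n}$ is the cohomology $H^0(C)$ at the center term of the complex $$C=\Big[\bigoplus_{\{i,i+1\}} l_i\cap l_{i+1}\xrightarrow{\ \partial\ }\bigoplus_{i\in\mathbb Z/n\mathbb Z}l_i\xrightarrow{\ \Sigma\ }V\Big],$$ which is placed in degrees $-1,0,1$.
   Context: $K_{1,2,\ldots,n}=\ker\big[\bigoplus_{i\in\mathbb Z/n\mathbb Z} l_i\xrightarrow{\Sigma}V\big]$, where $\Sigma(w)=\sum_i w_i$. Think of $\mathbb Z/n\mathbb Z$ as the vertices of an $n$-gon with one edge $\{i,i+1\}$ for each $i\in\mathbb Z/n\mathbb Z$ (for $n=2$ the two values of $i$ give two distinct edges); sums over $\{i,i+1\}$ are over edges. For $w\in K_{1,\ldots,n}$, an anti-derivative of $w$ is a family $\hat w=(\hat w_{\{i,i+1\}})$ of elements of $V$ indexed by the edges with $\hat w_{\{i,i+1\}}-\hat w_{\{i-1,i\}}=w_i$ for all $i$; it exists and is unique up to adding a constant vector of $V$. The symmetric bilinear form $q_{1,\ldots,n}$ on $K_{1,\ldots,n}$ is $$q_{1,2,\ldots,n}(v,w)=\sum_{i\in\mathbb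 Z/n\mathbb Z}B(v_i,\hat w_{\{i,i+1\}}),$$ for any choice of anti-derivative $\hat w$, and $\ker q_{1,\ldots,n}$ is its radical $\{w: q_{1,\ldots,n}(v,w)=0\ \forall v\in K_{1,\ldots,n}\}$. The map $\partial:\bigoplus_{\{i,i+1\}}l_i\cap l_{i+1}\to\bigoplus_i l_i$ is $(\partial a)_i=a_{\{i,i+1\}}-a_{\{i-1,i\}}$; its image lies in $K_{1,\ldots,n}$. *)

theory Defs
  imports Complex_Main "HOL-Library.Function_Algebras"
begin

text \<open>
  The ambient space \<open>V\<close> is the type \<open>'v\<close> with scalar multiplication \<open>scale\<close>
  over the field \<open>'f\<close>.
\<close>

locale symplectic_space = vector_space scale
  for scale :: "'f::field \<Rightarrow> 'v::ab_group_add \<Rightarrow> 'v" +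
  fixes B :: "'v \<Rightarrow> 'v \<Rightarrow> 'f"
  assumes finite_dimensional: "\<exists>Basis. finite_dimensional_vector_space scale Basis"
    and linear_left: "\<And>y. Vector_Spaces.linear scale (*) (\<lambda>x. B x y)"
    and linear_right: "\<And>x. Vector_Spaces.linear scale (*) (\<lambda>y. B x y)"
    and alternating: "\<And>x. B x x = 0"
    and nondegenerate: "\<And>x. (\<And>y. B x y = 0) \<Longrightarrow> x = 0"

definition lagrangian ::
  "('f::field \<Rightarrow> 'v::ab_group_add \<Rightarrow> 'v) \<Rightarrow> ('v \<Rightarrow> 'v \<Rightarrow> 'f) \<Rightarrow> 'v set \<Rightarrow> bool" where
  "lagrangian scale B L \<longleftrightarrow> module.subspace scale L \<and> L = {x. \<forall>y\<in>L. B x y = 0}"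


text \<open>
  The elements of \<open>\<int>/n\<int>\<close> are represented by \<open>0, \<dots>, n - 1\<close>, and the edge \<open>{i, i+1}\<close>
  of the \<open>n\<close>-gon by \<open>i\<close>, so that for \<open>n = 2\<close> there are two distinct edges. A family
  indexed by vertices or by edges is a function on \<open>nat\<close> that vanishes from \<open>n\<close> on, so that
  equality of families is equality of functions; families are added pointwise.
\<close>

definition next_vertex :: "nat \<Rightarrow> nat \<Rightarrow> nat" where
  "next_vertex n i = (i + 1) mod n"

definition prev_vertex :: "nat \<Rightarrow> nat \<Rightarrow> nat" where
  "prev_vertex n i = (i + n - 1) mod n"

definition direct_sum :: "nat \<Rightarrow> (nat \<Rightarrow> 'v::ab_group_add set) \<Rightarrow> (nat \<Rightarrow> 'v) set" where
  "direct_sum n X = {w. (\<forall>i<n. w i \<in> X i) \<and> (\<forall>i\<ge>n. w i = 0)}"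

definition scale_family :: "('f \<Rightarrow> 'v \<Rightarrow> 'v) \<Rightarrow> 'f \<Rightarrow> (nat \<Rightarrow> 'v) \<Rightarrow> (nat \<Rightarrow> 'v)" where
  "scale_family scale c w = (\<lambda>i. scale c (w i))"

definition family_sum :: "nat \<Rightarrow> (nat \<Rightarrow> 'v::ab_group_add) \<Rightarrow> 'v" where
  "family_sum n w = (\<Sum>i<n. w i)"

definition K :: "nat \<Rightarrow> (nat \<Rightarrow> 'v::ab_group_add set) \<Rightarrow> (nat \<Rightarrow> 'v) set" where
  "K n l = {w \<in> direct_sum n l. family_sum n w = 0}"

definition antiderivative ::
  "nat \<Rightarrow> (nat \<Rightarrow> 'v::ab_group_add) \<Rightarrow> (nat \<Rightarrow> 'v) \<Rightarrow> bool" where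
  "antiderivative n w h \<longleftrightarrow>
     h \<in> direct_sum n (\<lambda>_. UNIV) \<and> (\<forall>i<n. h i - h (prev_vertex n i) = w i)"

text \<open>
  On \<open>K n l\<close> the following does not depend on the antiderivative picked by \<open>SOME\<close>;
  see \<open>q_eq\<close> below.
\<close>

definition q ::
  "('v::ab_group_add \<Rightarrow> 'v \<Rightarrow> 'f::field) \<Rightarrow> nat \<Rightarrow> (nat \<Rightarrow> 'v) \<Rightarrow> (nat \<Rightarrow> 'v) \<Rightarrow> 'f" where
  "q B n v w = (let h = (SOME h. antiderivative n w h) in \<Sum>i<n. B (v i) (h i))"

definition radical_q ::
  "('v::ab_group_add \<Rightarrow> 'v \<Rightarrow> 'f::field) \<Rightarrow> nat \<Rightarrow> (nat \<Rightarrow> 'v set) \<Rightarrow> (nat \<Rightarrow> 'v) set" where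
  "radical_q B n l = {w \<in> K n l. \<forall>v\<in>K n l. q B n v w = 0}"

definition edge_sum :: "nat \<Rightarrow> (nat \<Rightarrow> 'v::ab_group_add set) \<Rightarrow> (nat \<Rightarrow> 'v) set" where
  "edge_sum n l = direct_sum n (\<lambda>i. l i \<inter> l (next_vertex n i))"

definition boundary :: "nat \<Rightarrow> (nat \<Rightarrow> 'v::ab_group_add) \<Rightarrow> (nat \<Rightarrow> 'v)" where
  "boundary n a = (\<lambda>i. if i < n then a i - a (prev_vertex n i) else 0)"


text \<open>
  The quotient of a subspace \<open>U\<close> by a subspace \<open>W \<subseteq> U\<close>, as the set of cosets together with its
  operations. In the scalar multiplication \<open>W\<close> is added so that multiplication by \<open>0\<close>
  yields the coset \<open>W\<close>.
\<close>

record ('f, 'u) vspace =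
  vs_carrier :: "'u set"
  vs_add :: "'u \<Rightarrow> 'u \<Rightarrow> 'u"
  vs_scale :: "'f \<Rightarrow> 'u \<Rightarrow> 'u"

definition coset :: "'u::ab_group_add set \<Rightarrow> 'u \<Rightarrow> 'u set" where
  "coset W u = {u + w | w. w \<in> W}"

definition quotient_space ::
  "('f \<Rightarrow> 'u::ab_group_add \<Rightarrow> 'u) \<Rightarrow> 'u set \<Rightarrow> 'u set \<Rightarrow> ('f, 'u set) vspace" where
  "quotient_space scale U W =
     \<lparr> vs_carrier = coset W ` U,
       vs_add = (\<lambda>X Y. {x + y | x y. x \<in> X \<and> y \<in> Y}),
       vs_scale = (\<lambda>c X. {scale c x + w | x w. x \<in> X \<and> w \<in> W}) \<rparr>"

definition middle_cohomology ::
  "('f \<Rightarrow> 'u::ab_group_add \<Rightarrow> 'u) \<Rightarrow> 'a set \<Rightarrow> ('a \<Rightarrow> 'u) \<Rightarrow> 'u set \<Rightarrow> ('u \<Rightarrow> 'v::zero)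
     \<Rightarrow> ('f, 'u set) vspace" where
  "middle_cohomology scale A d U e = quotient_space scale {u \<in> U. e u = 0} (d ` A)"

definition T ::
  "('f::field \<Rightarrow> 'v::ab_group_add \<Rightarrow> 'v) \<Rightarrow> ('v \<Rightarrow> 'v \<Rightarrow> 'f) \<Rightarrow> nat \<Rightarrow> (nat \<Rightarrow> 'v set)
     \<Rightarrow> ('f, (nat \<Rightarrow> 'v) set) vspace" where
  "T scale B n l = quotient_space (scale_family scale) (K n l) (radical_q B n l)"

definition H0 ::
  "('f::field \<Rightarrow> 'v::ab_group_add \<Rightarrow> 'v) \<Rightarrow> nat \<Rightarrow> (nat \<Rightarrow> 'v set)
     \<Rightarrow> ('f, (nat \<Rightarrow> 'v) set) vspace" where
  "H0 scale n l =
     middle_cohomology (scale_family scale) (edge_sum n l) (boundary n) (direct_sum n l) (family_sum n)"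


lemma prev_vertex_eq: "i < n \<Longrightarrow> prev_vertex n i = (if i = 0 then n - 1 else i - 1)"
  by (auto simp: prev_vertex_def mod_if)

lemma next_prev_vertex: "i < n \<Longrightarrow> next_vertex n (prev_vertex n i) = i"
  by (auto simp: prev_vertex_eq next_vertex_def)

lemma prev_vertex_less: "i < n \<Longrightarrow> prev_vertex n i < n"
  by (auto simp: prev_vertex_eq)

lemma sum_prev_vertex: "(\<Sum>i<n. g (prev_vertex n i)) = (\<Sum>i<n. g i)"
  for g :: "nat \<Rightarrow> 'a::ab_group_add"
proof (cases n)
  case (Suc m)
  have "(\<Sum>i<Suc m. g (prev_vertex n i)) = g m + (\<Sum>i<m. g (prev_vertex n (Suc i)))"
    by (subst sum.lessThan_Suc_shift) (simp add: prev_vertex_eq Suc)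
  also have "(\<Sum>i<m. g (prev_vertex n (Suc i))) = (\<Sum>i<m. g i)"
    by (rule sum.cong) (auto simp: prev_vertex_eq Suc)
  finally show ?thesis by (simp add: Suc add.commute)
qed simp

lemma antiderivative_exists:
  assumes "family_sum n w = 0"
  shows "\<exists>h. antiderivative n w h"
proof -
  let ?h = "\<lambda>i. if i < n then \<Sum>j<Suc i. w j else 0"
  have "?h i - ?h (prev_vertex n i) = w i" if "i < n" for i
  proof (cases i)
    case 0
    with that assms show ?thesis
      by (cases n) (auto simp: prev_vertex_eq family_sum_def)
  next
    case (Suc j)
    with that show ?thesis by (simp add: prev_vertex_eq)
  qed
  hence "antiderivative n w ?h" by (simp add: antiderivative_def direct_sum_def)
  thus ?thesis by blast
qed

lemma antiderivative_unique:
  assumes "antiderivative n w h" "antiderivative n w h'"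
  shows "\<exists>c. \<forall>i<n. h' i = h i + c"
proof -
  have "h' i = h i + (h' 0 - h 0)" if "i < n" for i
    using that
  proof (induction i)
    case (Suc i)
    from assms Suc.prems have "h (Suc i) - h (prev_vertex n (Suc i)) = w (Suc i)"
      "h' (Suc i) - h' (prev_vertex n (Suc i)) = w (Suc i)"
      by (auto simp: antiderivative_def)
    with Suc.prems have "h (Suc i) = w (Suc i) + h i" "h' (Suc i) = w (Suc i) + h' i"
      by (simp_all add: prev_vertex_eq diff_eq_eq)
    with Suc show ?case by (simp add: add.assoc)
  qed simp
  thus ?thesis by blast
qed

context symplectic_space
begin

lemma B_simps:
  "B (x + y) z = B x z + B y z" "B (x - y) z = B x z - B y z"
  "B z (x + y) = B z x + B z y" "B z (x - y) = B z x - B z y"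
  "B (scale c x) z = c * B x z" "B z (scale c x) = c * B z x"
  "B 0 z = 0" "B z 0 = 0"
proof -
  interpret L: Vector_Spaces.linear scale "(*)" "\<lambda>x. B x z" by (rule linear_left)
  interpret R: Vector_Spaces.linear scale "(*)" "B z" by (rule linear_right)
  show "B (x + y) z = B x z + B y z" "B (x - y) z = B x z - B y z"
    "B z (x + y) = B z x + B z y" "B z (x - y) = B z x - B z y"
    "B (scale c x) z = c * B x z" "B z (scale c x) = c * B z x"
    "B 0 z = 0" "B z 0 = 0"
    by (simp_all add: L.add L.diff L.scale L.zero R.add R.diff R.scale R.zero)
qed

lemma B_sum_left: "B (\<Sum>i\<in>A. f i) z = (\<Sum>i\<in>A. B (f i) z)"
  by (induction A rule: infinite_finite_induct) (simp_all add: B_simps)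

lemma B_skew: "B y x = - B x y"
proof -
  have "B y x + B x y = 0"
    using alternating[of "x + y"] alternating[of x] alternating[of y]
    unfolding B_simps(1,3) by (simp add: add.commute)
  then show ?thesis by (simp add: eq_neg_iff_add_eq_0)
qed

lemma q_eq:
  assumes v: "family_sum n v = 0" and h: "antiderivative n w h"
  shows "q B n v w = (\<Sum>i<n. B (v i) (h i))"
proof -
  define h' where "h' = (SOME h. antiderivative n w h)"
  have "antiderivative n w h'"
    unfolding h'_def by (rule someI[of _ h]) (rule h)
  then obtain c where c: "\<forall>i<n. h' i = h i + c"
    using antiderivative_unique[OF h] by blast
  have "q B n v w = (\<Sum>i<n. B (v i) (h' i))"
    by (simp add: q_def h'_def Let_def)
  also have "\<dots> = (\<Sum>i<n. B (v i) (h i) + B (v i) c)"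
    by (rule sum.cong) (auto simp: c B_simps)
  also have "\<dots> = (\<Sum>i<n. B (v i) (h i)) + B (family_sum n v) c"
    by (simp add: sum.distrib family_sum_def B_sum_left)
  finally show ?thesis using v by (simp add: B_simps)
qed

lemma q_sym:
  assumes l: "\<And>i. i < n \<Longrightarrow> lagrangian scale B (l i)" and v: "v \<in> K n l" and w: "w \<in> K n l"
  shows "q B n v w = q B n w v"
proof -
  from v w obtain g h where g: "antiderivative n v g" and h: "antiderivative n w h"
    using antiderivative_exists unfolding K_def by blast
  let ?p = "prev_vertex n"
  have 0: "B (g i - g (?p i)) (h i - h (?p i)) = 0" if "i < n" for i
    using that l[OF that] v w g h
    by (auto simp: lagrangian_def K_def direct_sum_def antiderivative_def)
  have "q B n v w - q B n w v = (\<Sum>i<n. B (g i - g (?p i)) (h i) - B (h i - h (?p i)) (g i))"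
    using v w g h by (simp add: q_eq K_def antiderivative_def sum_subtractf)
  also have "\<dots> = (\<Sum>i<n. B (g i - g (?p i)) (h i - h (?p i)) + B (g i) (h i) - B (g (?p i)) (h (?p i)))"
    by (rule sum.cong) (simp_all add: B_simps B_skew[of "h _"])
  also have "\<dots> = (\<Sum>i<n. B (g i) (h i) - B (g (?p i)) (h (?p i)))"
    by (rule sum.cong) (simp_all add: 0)
  also have "\<dots> = 0"
    using sum_prev_vertex[of "\<lambda>i. B (g i) (h i)" n] by (simp add: sum_subtractf)
  finally show ?thesis by simp
qed

lemma boundary_in_K:
  assumes l: "\<And>i. i < n \<Longrightarrow> lagrangian scale B (l i)"
  shows "boundary n ` edge_sum n l \<subseteq> K n l"
proof clarify
  fix a assume a: "a \<in> edge_sum n l"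
  have "a i - a (prev_vertex n i) \<in> l i" if "i < n" for i
  proof -
    have "a i \<in> l i" "a (prev_vertex n i) \<in> l i"
      using a that prev_vertex_less[OF that] next_prev_vertex[OF that]
      by (auto simp: edge_sum_def direct_sum_def)
    thus ?thesis using l[OF that] subspace_diff by (auto simp: lagrangian_def)
  qed
  moreover have "family_sum n (boundary n a) = 0"
    using sum_prev_vertex[of a n] by (simp add: family_sum_def boundary_def sum_subtractf)
  ultimately show "boundary n a \<in> K n l"
    by (auto simp: K_def direct_sum_def boundary_def)
qed

lemma vector_space_family: "vector_space (scale_family scale)"
  by unfold_locales
    (simp_all add: scale_family_def fun_eq_iff scale_right_distrib scale_left_distrib)

lemma subspace_K:
  assumes l: "\<And>i. i < n \<Longrightarrow> lagrangian scale B (l i)"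
  shows "module.subspace (scale_family scale) (K n l)"
proof -
  interpret F: vector_space "scale_family scale" by (rule vector_space_family)
  have l': "subspace (l i)" if "i < n" for i using l[OF that] by (simp add: lagrangian_def)
  have "(\<Sum>i<n. scale c (x i)) = scale c (\<Sum>i<n. x i)" for c x
    by (simp add: scale_sum_right)
  then show ?thesis
    by (auto simp: F.subspace_def K_def direct_sum_def family_sum_def sum.distrib scale_family_def
        intro: l' subspace_0 subspace_add subspace_scale)
qed

lemma subspace_radical_q:
  assumes l: "\<And>i. i < n \<Longrightarrow> lagrangian scale B (l i)"
  shows "module.subspace (scale_family scale) (radical_q B n l)"
proof -
  interpret F: vector_space "scale_family scale" by (rule vector_space_family)
  note K = subspace_K[OF l]
  have q_left: "q B n 0 v = 0" "q B n (x + y) v = q B n x v + q B n y v"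
    "q B n (scale_family scale c x) v = c * q B n x v" for c x y v
    by (simp_all add: q_def Let_def scale_family_def B_simps sum.distrib sum_distrib_left)
  have "radical_q B n l = {w \<in> K n l. \<forall>v\<in>K n l. q B n w v = 0}"
    using q_sym[OF l] by (auto simp: radical_q_def)
  then show ?thesis
    using F.subspace_0[OF K] F.subspace_add[OF K] F.subspace_scale[OF K]
    by (auto intro!: F.subspaceI simp: q_left)
qed

end

text \<open>The operations on cosets are those induced by the operations on representatives.\<close>

context vector_space
begin

lemma coset_eq_iff:
  assumes "subspace W"
  shows "coset W u = coset W v \<longleftrightarrow> u - v \<in> W"
proof
  assume "coset W u = coset W v"
  moreover have "u \<in> coset W u" using subspace_0[OF assms] by (force simp: coset_def)
  ultimately show "u - v \<in> W" by (auto simp: coset_def)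
next
  assume *: "u - v \<in> W"
  show "coset W u = coset W v"
  proof (intro set_eqI iffI)
    fix x assume "x \<in> coset W u"
    then obtain w where "w \<in> W" "x = u + w" by (auto simp: coset_def)
    then have "(u - v) + w \<in> W" "x = v + ((u - v) + w)"
      using * subspace_add[OF assms] by auto
    then show "x \<in> coset W v" unfolding coset_def by blast
  next
    fix x assume "x \<in> coset W v"
    then obtain w where "w \<in> W" "x = v + w" by (auto simp: coset_def)
    then have "w - (u - v) \<in> W" "x = u + (w - (u - v))"
      using * subspace_diff[OF assms] by auto
    then show "x \<in> coset W u" unfolding coset_def by blast
  qed
qed

lemma quotient_space_add:
  assumes "subspace W"
  shows "vs_add (quotient_space scale U W) (coset W u) (coset W v) = coset W (u + v)"
proof (intro set_eqI iffI)
  fix x assume "x \<in> vs_add (quotient_space scale U W) (coset W u) (coset W v)"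
  then obtain w w' where "w \<in> W" "w' \<in> W" "x = (u + w) + (v + w')"
    by (auto simp: quotient_space_def coset_def)
  then have "w + w' \<in> W" "x = (u + v) + (w + w')"
    using subspace_add[OF assms] by (auto simp: algebra_simps)
  then show "x \<in> coset W (u + v)" unfolding coset_def by blast
next
  fix x assume "x \<in> coset W (u + v)"
  then obtain w where "w \<in> W" "x = (u + w) + (v + 0)"
    by (auto simp: coset_def algebra_simps)
  then show "x \<in> vs_add (quotient_space scale U W) (coset W u) (coset W v)"
    using subspace_0[OF assms] unfolding quotient_space_def coset_def vspace.simps by blast
qed

lemma quotient_space_scale:
  assumes "subspace W"
  shows "vs_scale (quotient_space scale U W) c (coset W u) = coset W (scale c u)"
proof (intro set_eqI iffI)
  fix x assume "x \<in> vs_scale (quotient_space scale U W) c (coset W u)"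
  then obtain w w' where "w \<in> W" "w' \<in> W" "x = scale c (u + w) + w'"
    by (auto simp: quotient_space_def coset_def)
  then have "scale c w + w' \<in> W" "x = scale c u + (scale c w + w')"
    using subspace_add[OF assms] subspace_scale[OF assms] by (auto simp: scale_right_distrib)
  then show "x \<in> coset W (scale c u)" unfolding coset_def by blast
next
  fix x assume "x \<in> coset W (scale c u)"
  then obtain w where "w \<in> W" "x = scale c (u + 0) + w"
    by (auto simp: coset_def)
  then show "x \<in> vs_scale (quotient_space scale U W) c (coset W u)"
    using subspace_0[OF assms] unfolding quotient_space_def coset_def vspace.simps by blast
qed

end

end

theory Submission
  imports Defs
begin

text \<open>
  Let \<open>w \<in> K\<close> and let \<open>h\<close> be an antiderivative of \<open>w\<close>. That \<open>w\<close> lies in the radical of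
  \<open>q\<close> means that the functional \<open>\<phi> v = (\<Sum>i. B (v i) (h i))\<close> on \<open>\<Oplus>\<^sub>i l\<^sub>i\<close> vanishes on
  the kernel \<open>K\<close> of \<open>\<Sigma>\<close>. Equivalently, \<open>\<phi>\<close> factors through \<open>\<Sigma>\<close>, and, as \<open>B\<close> identifies
  \<open>V\<close> with its dual, \<open>\<phi> v = B (\<Sigma> v) c\<close> for some vector \<open>c\<close>
  (\<open>functional_vanishing_on_K\<close>). The antiderivative \<open>h - c\<close> of \<open>w\<close> then satisfies
  \<open>B x (h i - c) = 0\<close> for every \<open>x \<in> l i\<close>, so its value on the edge \<open>{i, i+1}\<close> lies in
  \<open>l i\<close>, because \<open>l i\<close> is its own orthogonal complement. Adding \<open>w (i+1) \<in> l (i+1)\<close> takes this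
  value to the one on the next edge, which lies in \<open>l (i+1)\<close>; hence \<open>h i - c\<close> lies in
  \<open>l (i+1)\<close> as well, and \<open>w = \<partial> (h - c)\<close> with \<open>h - c\<close> a family in \<open>\<Oplus> (l\<^sub>i \<inter> l\<^sub>i\<^sub>+\<^sub>1)\<close>.

  Conversely \<open>a\<close> is an antiderivative of \<open>\<partial> a\<close>, so \<open>q v (\<partial> a)\<close> is a sum of the terms
  \<open>B (v i) (a i)\<close>, each of which vanishes on the isotropic space \<open>l i\<close>. Since \<open>K\<close> is the
  kernel of \<open>\<Sigma>\<close>, the two quotients agree once the two subspaces do.
\<close>

context symplectic_space
begin

text \<open>
  With respect to a basis, \<open>y \<mapsto> (\<Sum>b. B b y \<cdot> b)\<close> is an endomorphism of \<open>V\<close> that is injective by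
  nondegeneracy, hence surjective by finite dimension; a preimage of \<open>\<Sum>b. \<psi> b \<cdot> b\<close>
  represents \<open>\<psi>\<close>.
\<close>

lemma functional_representation:
  assumes \<psi>: "Vector_Spaces.linear scale (*) \<psi>"
  shows "\<exists>c. \<forall>x. \<psi> x = B x c"
proof -
  obtain Basis where "finite_dimensional_vector_space scale Basis"
    using finite_dimensional by blast
  then interpret FD: finite_dimensional_vector_space scale Basis .
  interpret P: vector_space_pair scale "(*) :: 'f \<Rightarrow> 'f \<Rightarrow> 'f"
    by unfold_locales (simp_all add: algebra_simps)
  have eq_on_Basis: "f = g"
    if "Vector_Spaces.linear scale (*) f" "Vector_Spaces.linear scale (*) g"
      "\<And>b. b \<in> Basis \<Longrightarrow> f b = g b" for f g :: "'v \<Rightarrow> 'f"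
    using P.linear_eq_on[OF that(1,2)] that(3) FD.span_Basis by blast
  define M where "M y = (\<Sum>b\<in>Basis. scale (B b y) b)" for y
  have coords: "f b = g b" if "(\<Sum>b\<in>Basis. scale (f b) b) = (\<Sum>b\<in>Basis. scale (g b) b)" "b \<in> Basis"
    for f g b
  proof -
    have "(\<Sum>b\<in>Basis. scale (f b - g b) b) = 0"
      using that(1) by (simp add: scale_left_diff_distrib sum_subtractf)
    then show ?thesis
      using independentD[OF FD.independent_Basis FD.finite_Basis order_refl] that(2)
      by (metis right_minus_eq)
  qed
  have "Vector_Spaces.linear scale scale M"
    by unfold_locales
      (simp_all add: M_def B_simps scale_left_distrib sum.distrib scale_sum_right)
  moreover have "inj M"
  proof (rule injI)
    fix y z assume "M y = M z"
    then have "B b y = B b z" if "b \<in> Basis" for b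
      using coords[of "\<lambda>b. B b y" "\<lambda>b. B b z"] that unfolding M_def by blast
    then have "(\<lambda>x. B x y) = (\<lambda>x. B x z)"
      by (intro eq_on_Basis linear_left)
    then have "B x (y - z) = 0" for x
      by (simp add: B_simps fun_eq_iff)
    then have "B (y - z) x = 0" for x
      by (subst B_skew) simp
    then show "y = z"
      using nondegenerate[of "y - z"] by simp
  qed
  ultimately have "surj M"
    by (rule FD.linear_inj_imp_surj)
  then obtain c where c: "M c = (\<Sum>b\<in>Basis. scale (\<psi> b) b)"
    by (metis surjD)
  then have "B b c = \<psi> b" if "b \<in> Basis" for b
    using coords[of "\<lambda>b. B b c" \<psi>] that unfolding M_def by blast
  then have "\<psi> = (\<lambda>x. B x c)"
    by (intro eq_on_Basis linear_left \<psi>) simp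
  then show ?thesis by auto
qed

text \<open>
  Composing \<open>\<phi>\<close> with a linear section \<open>s\<close> of \<open>\<Sigma>\<close> gives a functional on \<open>V\<close>. It recovers \<open>\<phi>\<close>,
  because \<open>v\<close> and \<open>s (\<Sigma> v)\<close> differ by an element of \<open>K\<close>.
\<close>

lemma functional_vanishing_on_K:
  assumes l: "\<And>i. i < n \<Longrightarrow> subspace (l i)"
    and vanish: "\<And>v. v \<in> K n l \<Longrightarrow> (\<Sum>i<n. B (v i) (h i)) = 0"
  shows "\<exists>c. \<forall>v\<in>direct_sum n l. (\<Sum>i<n. B (v i) (h i)) = B (family_sum n v) c"
proof -
  interpret P: vector_space_pair "scale_family scale" scale
    by (intro vector_space_pair.intro vector_space_family vector_space_axioms)
  have lin: "Vector_Spaces.linear (scale_family scale) scale (family_sum n)"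
    by unfold_locales
      (simp_all add: family_sum_def scale_family_def sum.distrib scale_sum_right)
  have sub: "P.vs1.subspace (direct_sum n l)"
    using l by (auto simp: P.vs1.subspace_def direct_sum_def scale_family_def
        intro: subspace_0 subspace_add subspace_scale)
  obtain s where s: "range s \<subseteq> direct_sum n l"
      "Vector_Spaces.linear scale (scale_family scale) s"
      "\<And>x. x \<in> family_sum n ` direct_sum n l \<Longrightarrow> family_sum n (s x) = x"
    using P.linear_exists_right_inverse_on[OF lin sub] by blast
  interpret s: Vector_Spaces.linear scale "scale_family scale" s by (rule s(2))
  have "Vector_Spaces.linear scale (*) (\<lambda>x. \<Sum>i<n. B (s x i) (h i))"
    by unfold_locales
      (simp_all add: s.add s.scale scale_family_def B_simps sum.distrib sum_distrib_left
        algebra_simps)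
  then obtain c where c: "\<And>x. (\<Sum>i<n. B (s x i) (h i)) = B x c"
    using functional_representation by blast
  have "(\<Sum>i<n. B (v i) (h i)) = B (family_sum n v) c" if v: "v \<in> direct_sum n l" for v
  proof -
    let ?u = "s (family_sum n v)"
    have "v - ?u \<in> direct_sum n l"
      using s(1) v by (intro P.vs1.subspace_diff[OF sub]) auto
    moreover have "family_sum n ?u = family_sum n v"
      using s(3) v by blast
    ultimately have "v - ?u \<in> K n l"
      by (simp add: K_def family_sum_def sum_subtractf)
    from vanish[OF this] show ?thesis
      by (simp add: B_simps sum_subtractf c)
  qed
  then show ?thesis by blast
qed

lemma radical_q_subset_boundary:
  assumes l: "\<And>i. i < n \<Longrightarrow> lagrangian scale B (l i)"
  shows "radical_q B n l \<subseteq> boundary n ` edge_sum n l"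
proof
  fix w assume w: "w \<in> radical_q B n l"
  then have wK: "w \<in> K n l" by (simp add: radical_q_def)
  then obtain h where h: "antiderivative n w h"
    using antiderivative_exists unfolding K_def by blast
  have sub: "subspace (l i)" and perp: "l i = {x. \<forall>y\<in>l i. B x y = 0}" if "i < n" for i
    using l[OF that] by (auto simp: lagrangian_def)
  have "(\<Sum>i<n. B (v i) (h i)) = 0" if "v \<in> K n l" for v
    using w that q_eq[of n v w h] h by (simp add: radical_q_def K_def)
  then obtain c
    where c: "\<And>v. v \<in> direct_sum n l \<Longrightarrow> (\<Sum>i<n. B (v i) (h i)) = B (family_sum n v) c"
    using functional_vanishing_on_K[of n l h] sub by blast
  define a where "a i = (if i < n then h i - c else 0)" for i
  have a_l: "a i \<in> l i" if i: "i < n" for i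
  proof -
    have "B x (h i - c) = 0" if x: "x \<in> l i" for x
    proof -
      \<comment> \<open>A family supported at one vertex lies in \<open>K\<close> only if it is 0: the radical condition
        says nothing about it directly, and isolating \<open>h i\<close> takes the identity on all of
        \<open>\<Oplus>\<^sub>i l\<^sub>i\<close>.\<close>
      let ?v = "\<lambda>j. if j = i then x else 0"
      have "?v \<in> direct_sum n l"
        using i x sub subspace_0 by (auto simp: direct_sum_def)
      moreover have "(\<Sum>j<n. B (?v j) (h j)) = B x (h i)"
        using i by (simp add: if_distrib[of "\<lambda>y. B y _"] B_simps cong: if_cong)
      moreover have "family_sum n ?v = x"
        using i by (simp add: family_sum_def)
      ultimately show ?thesis
        using c[of ?v] by (simp add: B_simps)
    qed
    then have "\<forall>x\<in>l i. B (h i - c) x = 0"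
      by (subst B_skew) simp
    then show ?thesis
      using perp[OF i] i by (auto simp: a_def)
  qed
  have a_diff: "a i - a (prev_vertex n i) = w i" if "i < n" for i
    using that h prev_vertex_less[OF that] by (simp add: a_def antiderivative_def)
  have "a i \<in> l (next_vertex n i)" if i: "i < n" for i
  proof -
    let ?j = "next_vertex n i"
    have j: "?j < n" and p: "prev_vertex n ?j = i"
      using i by (auto simp: next_vertex_def prev_vertex_eq mod_if)
    have "a i = a ?j - w ?j"
      using a_diff[OF j] p by (simp add: algebra_simps)
    moreover have "w ?j \<in> l ?j"
      using wK j by (simp add: K_def direct_sum_def)
    ultimately show ?thesis
      using subspace_diff[OF sub[OF j] a_l[OF j]] by simp
  qed
  with a_l have "a \<in> edge_sum n l"
    by (simp add: edge_sum_def direct_sum_def a_def)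
  moreover have "w = boundary n a"
    using wK a_diff by (auto simp: boundary_def K_def direct_sum_def)
  ultimately show "w \<in> boundary n ` edge_sum n l" by blast
qed

lemma boundary_subset_radical_q:
  assumes l: "\<And>i. i < n \<Longrightarrow> lagrangian scale B (l i)"
  shows "boundary n ` edge_sum n l \<subseteq> radical_q B n l"
proof clarify
  fix a assume a: "a \<in> edge_sum n l"
  then have anti: "antiderivative n (boundary n a) a"
    by (simp add: antiderivative_def boundary_def edge_sum_def direct_sum_def)
  have "q B n v (boundary n a) = 0" if v: "v \<in> K n l" for v
  proof -
    have "B (v i) (a i) = 0" if "i < n" for i
    proof -
      have "v i \<in> l i" "a i \<in> l i"
        using a v that by (auto simp: K_def edge_sum_def direct_sum_def)
      then show ?thesis
        using l[OF that] unfolding lagrangian_def by blast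
    qed
    then show ?thesis
      using q_eq[OF _ anti] v by (simp add: K_def)
  qed
  then show "boundary n a \<in> radical_q B n l"
    using boundary_in_K[of n l] l a by (auto simp: radical_q_def)
qed

end

theorem proposition3:
  fixes scale :: "'f::field \<Rightarrow> 'v::ab_group_add \<Rightarrow> 'v"
    and B :: "'v \<Rightarrow> 'v \<Rightarrow> 'f"
    and n :: nat
    and l :: "nat \<Rightarrow> 'v set"
  assumes "CHAR('f) \<noteq> 2"
    and "symplectic_space scale B"
    and "n \<ge> 2"
    and "\<And>i. i < n \<Longrightarrow> lagrangian scale B (l i)"
  shows "radical_q B n l = boundary n ` edge_sum n l \<and>
         T scale B n l = H0 scale n l"
proof -
  interpret symplectic_space scale B by fact
  have "radical_q B n l = boundary n ` edge_sum n l"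
    using radical_q_subset_boundary boundary_subset_radical_q assms(4) by blast
  then show ?thesis
    by (simp add: T_def H0_def middle_cohomology_def K_def)
qed

end
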